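(* Suppose $r(i,a)\ge 0$ for all $i\in S$ and all $a\in A(i)$. Then the Projective Operator $Z$ satisfies both of the following conditions: (A) $ZV\subset V$; (B) $Zv\le v$ for all $v\in V$.
   Context: Consider an infinite horizon Markov decision process with finite state set $S$, a finite (nonempty) set of actions $A(i)$ for each $i\in S$, real immediate rewards $r(i,a)$ for $i\in S$, $a\in A(i)$, transition probabilities $p_{ij}(a)$ for $i,j\in S$, $a\in A(i)$ (so $p_{ij}(a)\ge 0$ and $\sum_{j\in S}p_{ij}(a)=1$), and discount factor $\lambda$ with $0\le\lambda<1$. Inequalities between vectors in $\mathbb{R}^{|S|}$ are component-wise. The operator $T:\mathbb{R}^{|S|}\to\mathbb{R}^{|S|}$ is $$(Tv)_i=\max_{a\in A(i)}\Bigl\{r(i,a)+\lambda\sum_{j\in S}p_{ij}(a)v_j\Bigr\},\quad i\in S,$$ and $V=\{v\in\mathbb{R}^{|S|}\mid v\ge Tv\}$. Projective Operator: for $v\in V$, $Zv=\alpha^* v$, where $\alpha^*\in\mathbb{R}$ is the optimal solution of the one-variable optimization problem $$\min\Bigl\{\alpha\sum_{i\in S}v_i \;\Big|\; \alpha\in\mathbb{R},\ T(\alpha v)\le\alpha v\Bigr\}.$$ *)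

theory Defs
  imports "HOL-Analysis.Analysis"
begin

text \<open>
  States are the elements of a finite type, so \<^typ>\<open>real ^ 's\<close> is the space of value vectors, and
  its library order is the componentwise one. \<open>A i\<close> is the set of actions available in state \<open>i\<close>;
  \<open>r i a\<close> and \<open>p i a j\<close> are only meaningful for \<open>a \<in> A i\<close>.
\<close>

definition bellman ::
    "('s::finite \<Rightarrow> 'a set) \<Rightarrow> ('s \<Rightarrow> 'a \<Rightarrow> real) \<Rightarrow> ('s \<Rightarrow> 'a \<Rightarrow> 's \<Rightarrow> real) \<Rightarrow> real
      \<Rightarrow> real ^ 's \<Rightarrow> real ^ 's" where
  "bellman A r p l v =
    (\<chi> i. Max ((\<lambda>a. r i a + l * (\<Sum>j\<in>UNIV. p i a j * v $ j)) ` A i))"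

definition bellman_super ::
    "('s::finite \<Rightarrow> 'a set) \<Rightarrow> ('s \<Rightarrow> 'a \<Rightarrow> real) \<Rightarrow> ('s \<Rightarrow> 'a \<Rightarrow> 's \<Rightarrow> real) \<Rightarrow> real
      \<Rightarrow> (real ^ 's) set" where
  "bellman_super A r p l = {v. v \<ge> bellman A r p l v}"

text \<open>
  The optimal scalar need not be unique: if \<open>v = 0\<close> is feasible then every scalar is optimal, and
  \<^const>\<open>arg_min\<close> selects an arbitrary one. This does not affect \<open>proj_op\<close>, which is then \<open>0\<close>.
  If no minimiser exists, the value of \<^const>\<open>arg_min\<close> is unspecified.
\<close>

definition proj_op ::
    "('s::finite \<Rightarrow> 'a set) \<Rightarrow> ('s \<Rightarrow> 'a \<Rightarrow> real) \<Rightarrow> ('s \<Rightarrow> 'a \<Rightarrow> 's \<Rightarrow> real) \<Rightarrow> real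
      \<Rightarrow> real ^ 's \<Rightarrow> real ^ 's" where
  "proj_op A r p l v =
    (ARG_MIN (\<lambda>\<alpha>. \<alpha> * (\<Sum>i\<in>UNIV. v $ i)) \<alpha>. bellman A r p l (\<alpha> *\<^sub>R v) \<le> \<alpha> *\<^sub>R v) *\<^sub>R v"

end

theory Submission
  imports Defs
begin

text \<open>
  With nonnegative rewards, a discounted minimum principle makes every \<open>v \<ge> T v\<close> nonnegative. It
  applies to \<open>v\<close> itself and to every feasible multiple \<open>\<alpha> v\<close>. Hence, if \<open>v \<noteq> 0\<close>, the sum of the
  entries of \<open>v\<close> is positive, no negative scalar is feasible, and minimising the objective means
  minimising \<open>\<alpha>\<close>. The feasible scalars form a closed set, cut out by finitely many weak affine
  inequalities, and \<open>1\<close> is among them, so the minimum \<open>\<alpha>\<^sup>*\<close> exists and satisfies \<open>\<alpha>\<^sup>* \<le> 1\<close>.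
  Feasibility of \<open>\<alpha>\<^sup>*\<close> is (A), and \<open>\<alpha>\<^sup>* v \<le> v\<close> because \<open>v \<ge> 0\<close>. If \<open>v = 0\<close>, every multiple of \<open>v\<close>
  is \<open>v\<close>, so both claims hold whichever scalar is selected.
\<close>

lemma bellman_le_iff:
  fixes A :: "'s::finite \<Rightarrow> 'a set"
  assumes "\<And>i. finite (A i)" and "\<And>i. A i \<noteq> {}"
  shows "bellman A r p l v \<le> w \<longleftrightarrow>
    (\<forall>i. \<forall>a\<in>A i. r i a + l * (\<Sum>j\<in>UNIV. p i a j * v $ j) \<le> w $ i)"
  using assms by (simp add: bellman_def less_eq_vec_def)

text \<open>
  Minimum principle: where \<open>v\<close> attains its minimum \<open>m\<close>, the averages on the right-hand side of the
  Bellman inequality are at least \<open>m\<close>, so \<open>m \<ge> l m\<close>, which forces \<open>m \<ge> 0\<close> as \<open>l < 1\<close>.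
\<close>

lemma bellman_super_nonneg:
  fixes A :: "'s::finite \<Rightarrow> 'a set" and v :: "real ^ 's"
  assumes fin: "\<And>i. finite (A i)" and ne: "\<And>i. A i \<noteq> {}"
    and p_nonneg: "\<And>i a j. a \<in> A i \<Longrightarrow> 0 \<le> p i a j"
    and p_sum: "\<And>i a. a \<in> A i \<Longrightarrow> (\<Sum>j\<in>UNIV. p i a j) = 1"
    and "0 \<le> l" and "l < 1"
    and r_nonneg: "\<And>i a. a \<in> A i \<Longrightarrow> 0 \<le> r i a"
    and super: "bellman A r p l v \<le> v"
  shows "0 \<le> v"
proof -
  define m where "m = Min (range (($) v))"
  have m_le: "m \<le> v $ j" for j
    by (simp add: m_def)
  have "m \<in> range (($) v)"
    unfolding m_def by (rule Min_in) auto
  then obtain i where i: "v $ i = m"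
    by auto
  obtain a where a: "a \<in> A i"
    using ne by blast
  have "m = (\<Sum>j\<in>UNIV. p i a j * m)"
    using p_sum[OF a] by (simp flip: sum_distrib_right)
  also have "\<dots> \<le> (\<Sum>j\<in>UNIV. p i a j * v $ j)"
    by (intro sum_mono mult_left_mono m_le p_nonneg a)
  finally have "l * m \<le> l * (\<Sum>j\<in>UNIV. p i a j * v $ j)"
    using \<open>0 \<le> l\<close> by (rule mult_left_mono)
  moreover have "r i a + l * (\<Sum>j\<in>UNIV. p i a j * v $ j) \<le> m"
    using super a i by (auto simp: bellman_le_iff[OF fin ne])
  ultimately have "0 \<le> (1 - l) * m"
    using r_nonneg[OF a] by (simp add: algebra_simps)
  then have "0 \<le> m"
    using \<open>l < 1\<close> by (simp add: zero_le_mult_iff)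
  then show ?thesis
    using m_le by (auto simp: less_eq_vec_def intro: order_trans)
qed

lemma closed_feasible_scalars:
  fixes A :: "'s::finite \<Rightarrow> 'a set" and v :: "real ^ 's"
  assumes fin: "\<And>i. finite (A i)" and ne: "\<And>i. A i \<noteq> {}"
  shows "closed {\<alpha>::real. bellman A r p l (\<alpha> *\<^sub>R v) \<le> \<alpha> *\<^sub>R v}"
  unfolding bellman_le_iff[OF fin ne] Ball_def
  by (intro closed_Collect_all closed_Collect_imp open_Collect_const closed_Collect_le
      continuous_intros)

text \<open>
  Since \<open>1\<close> is feasible and negative scalars are not, a minimum over the compact set of feasible
  scalars in \<open>[0, 1]\<close> is a minimum over all feasible scalars, and a positive entry sum turns the
  order of the objective values into the order of the scalars.
\<close>

lemma proj_op_optimal_scalar: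
  fixes A :: "'s::finite \<Rightarrow> 'a set" and v :: "real ^ 's"
  assumes fin: "\<And>i. finite (A i)" and ne: "\<And>i. A i \<noteq> {}"
    and nonneg: "\<And>\<alpha>::real. bellman A r p l (\<alpha> *\<^sub>R v) \<le> \<alpha> *\<^sub>R v \<Longrightarrow> 0 \<le> \<alpha>"
    and sum_pos: "0 < (\<Sum>i\<in>UNIV. v $ i)"
    and super: "bellman A r p l v \<le> v"
  obtains \<alpha> where "proj_op A r p l v = \<alpha> *\<^sub>R v"
    and "bellman A r p l (\<alpha> *\<^sub>R v) \<le> \<alpha> *\<^sub>R v" and "\<alpha> \<le> 1"
proof -
  let ?P = "\<lambda>\<alpha>::real. bellman A r p l (\<alpha> *\<^sub>R v) \<le> \<alpha> *\<^sub>R v"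
  let ?f = "\<lambda>\<alpha>::real. \<alpha> * (\<Sum>i\<in>UNIV. v $ i)"
  have one: "?P 1"
    using super by simp
  let ?K = "{0..1} \<inter> {\<alpha>. ?P \<alpha>}"
  have compact: "compact ?K"
    by (intro compact_Int_closed compact_Icc closed_feasible_scalars fin ne)
  have "1 \<in> ?K"
    using super by simp
  then have nonempty: "?K \<noteq> {}"
    by (rule ex_in_conv[THEN iffD1, OF exI])
  obtain m where m: "m \<in> ?K" and m_le: "\<forall>\<alpha>\<in>?K. m \<le> \<alpha>"
    using compact_attains_inf[OF compact nonempty] by (rule bexE)
  have m_min: "m \<le> \<alpha>" if "?P \<alpha>" for \<alpha>
    using m bspec[OF m_le, of \<alpha>] nonneg[OF that] that by (cases "\<alpha> \<le> 1") auto
  have "?P (arg_min ?f ?P) \<and> arg_min ?f ?P \<le> 1"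
  proof (rule arg_minI[where x = m])
    show "?P m"
      using m by simp
    show "\<not> ?f \<alpha> < ?f m" if "?P \<alpha>" for \<alpha>
      using m_min[OF that] sum_pos by simp
    show "?P x \<and> x \<le> 1" if "?P x" and "\<forall>y. ?P y \<longrightarrow> \<not> ?f y < ?f x" for x
      using that one sum_pos by (force simp: not_less)
  qed
  then show thesis
    using that by (auto simp: proj_op_def)
qed

theorem theorem2p1:
  fixes A :: "'s::finite \<Rightarrow> 'a set"
    and r :: "'s \<Rightarrow> 'a \<Rightarrow> real"
    and p :: "'s \<Rightarrow> 'a \<Rightarrow> 's \<Rightarrow> real"
    and l :: real
  assumes "\<And>i. finite (A i)"
    and "\<And>i. A i \<noteq> {}"
    and "\<And>i a j. a \<in> A i \<Longrightarrow> 0 \<le> p i a j"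
    and "\<And>i a. a \<in> A i \<Longrightarrow> (\<Sum>j\<in>UNIV. p i a j) = 1"
    and "0 \<le> l"
    and "l < 1"
    and "\<And>i a. a \<in> A i \<Longrightarrow> 0 \<le> r i a"
  shows "proj_op A r p l ` bellman_super A r p l \<subseteq> bellman_super A r p l
    \<and> (\<forall>v\<in>bellman_super A r p l. proj_op A r p l v \<le> v)"
proof -
  have "bellman A r p l (proj_op A r p l v) \<le> proj_op A r p l v \<and> proj_op A r p l v \<le> v"
    if super: "bellman A r p l v \<le> v" for v
  proof (cases "v = 0")
    case True
    then have "proj_op A r p l v = v"
      by (simp add: proj_op_def)
    with super show ?thesis
      by simp
  next
    case False
    have super_nonneg: "0 \<le> w" if "bellman A r p l w \<le> w" for w
      using assms that by (rule bellman_super_nonneg)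
    have v_nonneg: "0 \<le> v $ i" for i
      using super_nonneg[OF super] by (simp add: less_eq_vec_def)
    obtain k where "v $ k \<noteq> 0"
      using False by (auto simp: vec_eq_iff)
    then have k: "0 < v $ k"
      using v_nonneg[of k] by simp
    have sum_pos: "0 < (\<Sum>i\<in>UNIV. v $ i)"
      using k v_nonneg by (intro sum_pos2[of _ k]) auto
    have scalar_nonneg: "0 \<le> \<alpha>" if "bellman A r p l (\<alpha> *\<^sub>R v) \<le> \<alpha> *\<^sub>R v" for \<alpha>
    proof -
      have "0 \<le> \<alpha> * v $ k"
        using super_nonneg[OF that] by (simp add: less_eq_vec_def)
      then show ?thesis
        using k by (simp add: zero_le_mult_iff)
    qed
    obtain \<alpha> where \<alpha>: "proj_op A r p l v = \<alpha> *\<^sub>R v"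
        "bellman A r p l (\<alpha> *\<^sub>R v) \<le> \<alpha> *\<^sub>R v" "\<alpha> \<le> 1"
      using assms(1,2) scalar_nonneg sum_pos super by (rule proj_op_optimal_scalar)
    have "\<alpha> *\<^sub>R v \<le> v"
      using mult_right_mono[OF \<open>\<alpha> \<le> 1\<close> v_nonneg] by (simp add: less_eq_vec_def)
    with \<alpha> show ?thesis
      by simp
  qed
  then show ?thesis
    by (auto simp: bellman_super_def)
qed

end
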